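(* Let $q$ be a power of a prime $p$ which is a perfect square, and let $\lambda\in\mathbb{F}_q^*$. (1) Let $d\ge 2$ be a divisor of $q-1$, and let $r$ be the remainder of $\frac{q-1}{d}$ upon division by $p\sqrt q$. If $r\le(p-1)\sqrt q$, then $MSD_d(\lambda,\mathbb{F}_q)\le\sqrt q-1$. (2) Let $q\ge 25$ and let $d\ge 3$ be a divisor of $q-1$, and let $r$ be the remainder of $\frac{q-1}{d}$ upon division by $p\sqrt q$. If $r\le(p-1)\sqrt q$, then $MD_d(\lambda,\mathbb{F}_q)\le\sqrt q-1$.
   Context: $S_d=\{x^d:x\in\mathbb{F}_q^*\}$. A set of distinct elements $a_1,\dots,a_m$ of $\mathbb{F}_q^*$ has property $D_d(\lambda,\mathbb{F}_q)$ if $a_ia_j+\lambda\in S_d\cup\{0\}$ whenever $i\ne j$, and property $SD_d(\lambda,\mathbb{F}_q)$ if $a_ia_j+\lambda\in S_d\cup\{0\}$ for all $i,j$ (including $i=j$). $MD_d(\lambda,\mathbb{F}_q)$, $MSD_d(\lambda,\mathbb{F}_q)$ are the maximum sizes of subsets of $\mathbb{F}_q^*$ with these respective properties. *)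

theory Defs
  imports "HOL-Computational_Algebra.Primes" "HOL-Library.Cardinality"
begin

definition power_residues :: "nat \<Rightarrow> 'a::field set" where
  "power_residues d = {x ^ d | x. x \<noteq> 0}"

definition prop_D :: "nat \<Rightarrow> 'a::field \<Rightarrow> 'a set \<Rightarrow> bool" where
  "prop_D d l A \<longleftrightarrow> A \<subseteq> UNIV - {0} \<and>
     (\<forall>a\<in>A. \<forall>b\<in>A. a \<noteq> b \<longrightarrow> a * b + l \<in> power_residues d \<union> {0})"

definition prop_SD :: "nat \<Rightarrow> 'a::field \<Rightarrow> 'a set \<Rightarrow> bool" where
  "prop_SD d l A \<longleftrightarrow> A \<subseteq> UNIV - {0} \<and>
     (\<forall>a\<in>A. \<forall>b\<in>A. a * b + l \<in> power_residues d \<union> {0})"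

text \<open>Over a finite field the sets of cardinalities below are finite, and they contain 0
  because of the empty set, so the maxima are genuine.\<close>

definition MD :: "nat \<Rightarrow> 'a::{field,finite} \<Rightarrow> nat" where
  "MD d l = Max {card A | A. prop_D d l A}"

definition MSD :: "nat \<Rightarrow> 'a::{field,finite} \<Rightarrow> nat" where
  "MSD d l = Max {card A | A. prop_SD d l A}"

end

theory Submission
  imports Defs "HOL-Computational_Algebra.Polynomial"
begin

text \<open>
  Write \<open>q = s\<^sup>2\<close> and \<open>N = (q - 1) / d = N\<^sub>1 s + N\<^sub>0\<close> with \<open>N\<^sub>0 < s\<close>. The condition on \<open>r\<close> says
  that \<open>e = N\<^sub>1 + 1\<close> is nonzero modulo \<open>p\<close>, and every \<open>z \<in> S\<^sub>d \<union> {0}\<close> satisfies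
  \<open>z ^ (s e) = z ^ M\<close> with \<open>M = s - N\<^sub>0\<close>. Suppose \<open>A\<close> has exactly \<open>s\<close> elements and choose weights
  \<open>c\<^sub>a\<close> with \<open>\<Sum> c\<^sub>a H(a) = H(0)\<close> for all polynomials \<open>H\<close> of degree less than \<open>s\<close>.

  For the strong property, \<open>\<Sum> c\<^sub>a (a x + l) ^ (s e) - l ^ M\<close> vanishes to order \<open>s\<close> at every
  element of \<open>A\<close>, since \<open>(a x + l) ^ s\<close> is constant modulo \<open>(x - b) ^ s\<close>; its degree \<open>s e\<close> is too
  small for that, and its coefficient at \<open>x ^ s\<close> is nonzero because \<open>e\<close> and \<open>\<Sum> c\<^sub>a a ^ s\<close> are.

  For the weak property nothing is known about the diagonal term \<open>a = b\<close>, so each summand is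
  multiplied by a power of \<open>x - a\<close>. Two such polynomials are used. If \<open>N\<^sub>0\<close> is large, take
  \<open>\<Sum> c\<^sub>a (a x + l) ^ (s e) (x - a) ^ (N\<^sub>0 - 1) - l ^ M x ^ (N\<^sub>0 - 1)\<close>, which vanishes to order
  \<open>N\<^sub>0 - 1\<close> on \<open>A \<union> {0}\<close>. If \<open>N\<^sub>0\<close> is small, take
  \<open>\<Sum> c\<^sub>a (a x + l) ^ (N + K) (x - a) ^ L - l ^ K x ^ L\<close> with \<open>K + L = s - 1\<close>, which vanishes to
  order \<open>min K L\<close> on \<open>A \<union> {0}\<close>; it is nonzero when a binomial coefficient is prime to \<open>p\<close>, which
  Lucas' theorem gives for \<open>K = (p div 2) (s / p)\<close>. Counting zeros leaves only \<open>s = 5\<close>,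
  \<open>d = 3\<close>, where the first polynomial would have to be a constant multiple of the square of
  \<open>x \<Prod> (x - a)\<close>, and comparing coefficients refutes this.
\<close>

section \<open>Finite fields and binomial coefficients in prime characteristic\<close>

lemma finite_field_power_card_minus_1:
  fixes x :: "'a::{field,finite}"
  assumes "x \<noteq> 0"
  shows "x ^ (CARD('a) - 1) = 1"
proof -
  have "(\<Prod>y\<in>UNIV-{0}. x * y) = (\<Prod>y\<in>UNIV-{0}. y)"
    by (rule prod.reindex_bij_witness[of _ "\<lambda>y. y / x" "\<lambda>y. x * y"]) (use assms in auto)
  moreover have "(\<Prod>y\<in>UNIV-{0}. x * y) = x ^ (CARD('a) - 1) * (\<Prod>y\<in>UNIV-{0}. y)"
    by (simp add: prod.distrib)
  ultimately show ?thesis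
    by (simp add: prod_zero_iff)
qed

lemma power_residues_Un_0_cases:
  fixes z :: "'a::{field,finite}"
  assumes "z \<in> power_residues d \<union> {0}" and "d dvd CARD('a) - 1"
  shows "z = 0 \<or> z ^ ((CARD('a) - 1) div d) = 1"
  using assms finite_field_power_card_minus_1[where ?'a = 'a]
  by (auto simp: power_residues_def simp flip: power_mult One_nat_def simp del: One_nat_def)

text \<open>Translation by 1 permutes the field, so comparing the sums over all elements shows that
  the field size is 0 in the field; hence the characteristic divides \<open>p ^ k\<close>.\<close>

lemma finite_field_CHAR_eq:
  assumes "prime p" and "CARD('a::{field,finite}) = p ^ k"
  shows "CHAR('a) = p"
proof -
  have "prime CHAR('a)"
    using finite_imp_CHAR_pos[where ?'a = 'a] prime_CHAR_semidom[where ?'a = 'a] by simp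
  moreover have "CHAR('a) dvd p ^ k"
  proof -
    have "(\<Sum>x\<in>UNIV. x + 1) = (\<Sum>x\<in>UNIV. x :: 'a)"
      by (rule sum.reindex_bij_witness[of _ "\<lambda>x. x - 1" "\<lambda>x. x + 1"]) auto
    then have "of_nat CARD('a) = (0 :: 'a)"
      by (simp add: sum.distrib)
    then show ?thesis
      unfolding assms(2) of_nat_eq_0_iff_char_dvd .
  qed
  ultimately show ?thesis
    using assms(1) prime_dvd_power primes_dvd_imp_eq by blast
qed

lemma diff_power_prime_power:
  fixes x y :: "'a::comm_ring_1"
  assumes "prime CHAR('a)" and "s = CHAR('a) ^ m"
  shows "(x - y) ^ s = x ^ s - y ^ s"
  using freshmans_dream'[OF assms, of "x - y" y] by simp

text \<open>By Frobenius the linear power is a polynomial in \<open>x ^ s\<close>. As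
  \<open>degree g < s\<close>, the shifted copies of \<open>g\<close> occupy disjoint blocks of
  exponents, so each coefficient comes from a single term.\<close>

lemma coeff_linear_power_mult_prime_power:
  fixes a l :: "'a::comm_ring_1"
  assumes "prime CHAR('a)" and "s = CHAR('a) ^ m" and "degree g < s" and "k < s"
  shows "coeff ([:l, a:] ^ (s * e) * g) (s * j + k) =
    of_nat (e choose j) * (a ^ s) ^ j * (l ^ s) ^ (e - j) * coeff g k"
proof -
  have "[:l, a:] ^ s = monom a 1 ^ s + [:l:] ^ s"
    using freshmans_dream'[of s m "monom a 1" "[:l:]"] assms by (simp add: monom_altdef)
  then have "[:l, a:] ^ (s * e) = (monom (a ^ s) s + [:l ^ s:]) ^ e"
    by (simp add: power_mult monom_power poly_const_pow)
  also have "\<dots> = (\<Sum>u\<le>e. monom (of_nat (e choose u) * (a ^ s) ^ u * (l ^ s) ^ (e - u)) (s * u))"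
    by (simp add: binomial_ring monom_power of_nat_poly smult_monom poly_const_pow mult_ac)
  finally have "coeff ([:l, a:] ^ (s * e) * g) (s * j + k) =
    (\<Sum>u\<le>e. if s * j + k < s * u then 0
      else of_nat (e choose u) * (a ^ s) ^ u * (l ^ s) ^ (e - u) * coeff g (s * j + k - s * u))"
    by (simp add: sum_distrib_right coeff_sum coeff_monom_mult)
  also have "\<dots> = (\<Sum>u\<le>e. if u = j then of_nat (e choose j) * (a ^ s) ^ j * (l ^ s) ^ (e - j) * coeff g k else 0)"
  proof (rule sum.cong)
    fix u
    consider "u < j" | "u = j" | "u > j" by linarith
    thus "(if s * j + k < s * u then 0
      else of_nat (e choose u) * (a ^ s) ^ u * (l ^ s) ^ (e - u) * coeff g (s * j + k - s * u))
        = (if u = j then of_nat (e choose j) * (a ^ s) ^ j * (l ^ s) ^ (e - j) * coeff g k else 0)"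
    proof cases
      case 1
      then have "s * u + s \<le> s * j"
        by (metis Suc_leI add.commute mult_Suc_right mult_le_mono2)
      then have "degree g < s * j + k - s * u" using assms(3) by linarith
      with 1 show ?thesis by (simp add: coeff_eq_0)
    next
      case 3
      then have "s * j + s \<le> s * u"
        by (metis Suc_leI add.commute mult_Suc_right mult_le_mono2)
      with 3 assms(4) show ?thesis by auto
    qed auto
  qed auto
  also have "\<dots> = of_nat (e choose j) * (a ^ s) ^ j * (l ^ s) ^ (e - j) * coeff g k"
    by (cases "j \<le> e") (auto simp: binomial_eq_0)
  finally show ?thesis .
qed

text \<open>Coefficient comparison in \<open>(1 + x) ^ (P * h) * (1 + x) ^ g\<close>: the second
  factor fits into one block of length \<open>P\<close>.\<close>

lemma lucas_prime_power:
  assumes "prime CHAR('a::comm_ring_1)" and "P = CHAR('a) ^ m" and "g < P" and "i < P"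
  shows "of_nat ((P * h + g) choose (P * j + i)) = (of_nat (h choose j) * of_nat (g choose i) :: 'a)"
proof -
  have deg: "degree ([:1, 1::'a:] ^ n) \<le> n" for n
    using degree_power_le[of "[:1, 1::'a:]" n] by simp
  have coeff_bin: "coeff ([:1, 1::'a:] ^ n) k = of_nat (n choose k)" for n k
    using deg[of n] by (cases "k \<le> n") (simp_all add: coeff_linear_poly_power binomial_eq_0 coeff_eq_0)
  have "coeff ([:1, 1::'a:] ^ (P * h) * [:1, 1:] ^ g) (P * j + i) = of_nat (h choose j) * of_nat (g choose i)"
    using coeff_linear_power_mult_prime_power[OF assms(1,2) le_less_trans[OF deg assms(3)] assms(4)]
    by (simp add: coeff_bin)
  then show ?thesis
    by (simp add: coeff_bin flip: power_add)
qed

section \<open>Polynomials with prescribed zeros and interpolation weights\<close>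

lemma prod_linear_power_dvd:
  fixes f :: "'a::field poly"
  assumes "finite A" and "\<And>a. a \<in> A \<Longrightarrow> [:-a, 1:] ^ n dvd f"
  shows "(\<Prod>a\<in>A. [:-a, 1:]) ^ n dvd f"
  using assms
proof (induction A rule: finite_induct)
  case (insert x A)
  then obtain g where g: "f = (\<Prod>a\<in>A. [:-a, 1:]) ^ n * g"
    by (metis dvdE insertI2)
  have "[:-x, 1:] ^ n dvd g"
  proof (cases "f = 0")
    case True
    with g insert.hyps show ?thesis by auto
  next
    case False
    \<comment> \<open>The factors already split off do not vanish at the new point \<open>x\<close>,
      so the whole order there comes from \<open>g\<close>.\<close>
    have "poly ((\<Prod>a\<in>A. [:-a, 1:]) ^ n) x \<noteq> 0"
      using insert.hyps by (auto simp: poly_prod)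
    then have "order x ((\<Prod>a\<in>A. [:-a, 1:]) ^ n) = 0"
      by (rule order_0I)
    with False g insert.prems[of x] show ?thesis
      by (auto simp: order_divides order_mult)
  qed
  then have "[:-x, 1:] ^ n * (\<Prod>a\<in>A. [:-a, 1:]) ^ n dvd f"
    by (subst g) (simp add: mult.commute[of "[:-x, 1:] ^ n"] mult_dvd_mono)
  with insert.hyps show ?case
    by (simp add: power_mult_distrib del: mult_pCons_left)
qed simp

text \<open>The weights are the values at 0 of the Lagrange basis polynomials for
  \<open>A\<close>.\<close>

lemma interpolation_weights_at_0:
  fixes A :: "'a::field set"
  assumes "finite A" and "0 \<notin> A" and "A \<noteq> {}"
  obtains c where "\<And>k. k < card A \<Longrightarrow> (\<Sum>a\<in>A. c a * a ^ k) = 0 ^ k"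
    and "(\<Sum>a\<in>A. c a * a ^ card A) \<noteq> 0"
proof
  define L where "L a = (\<Prod>b\<in>A-{a}. smult (inverse (a - b)) [:-b, 1:])" for a
  define c where "c a = poly (L a) 0" for a
  have card_pos: "card A > 0"
    using assms by (simp add: card_gt_0_iff)
  have degL: "degree (L a) < card A" if "a \<in> A" for a
  proof -
    have "degree (L a) \<le> (\<Sum>b\<in>A-{a}. degree (smult (inverse (a - b)) [:-b, 1:]))"
      unfolding L_def using degree_prod_sum_le assms(1) by (metis (no_types, lifting) comp_def finite_Diff sum.cong)
    also have "\<dots> \<le> (\<Sum>b\<in>A-{a}. 1)"
      by (rule sum_mono) auto
    also have "\<dots> < card A"
      using that assms card_pos by simp
    finally show ?thesis .
  qed
  have polyL: "poly (L a) b = (if a = b then 1 else 0)" if "a \<in> A" "b \<in> A" for a b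
  proof (cases "a = b")
    case True
    have "poly (smult (inverse (a - x)) [:-x, 1:]) a = 1" if "x \<in> A - {a}" for x
    proof -
      have "poly (smult (inverse (a - x)) [:-x, 1:]) a = inverse (a - x) * (a - x)"
        by (simp add: algebra_simps)
      also have "\<dots> = 1"
        using that by (intro left_inverse) auto
      finally show ?thesis .
    qed
    then show ?thesis
      unfolding L_def poly_prod True[symmetric] by simp
  next
    case False
    then have "\<exists>x\<in>A - {a}. poly (smult (inverse (a - x)) [:-x, 1:]) b = 0"
      using that by (intro bexI[of _ b]) auto
    with False assms(1) show ?thesis
      by (simp add: L_def poly_prod)
  qed
  have interp: "(\<Sum>a\<in>A. c a * poly H a) = poly H 0" if "degree H < card A" for H
  proof -
    have "(\<Sum>a\<in>A. smult (poly H a) (L a)) = H"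
    proof (rule poly_eqI_degree[where A = A])
      show "poly (\<Sum>a\<in>A. smult (poly H a) (L a)) x = poly H x" if "x \<in> A" for x
      proof -
        have "poly (\<Sum>a\<in>A. smult (poly H a) (L a)) x = (\<Sum>a\<in>A. if a = x then poly H x else 0)"
          unfolding poly_sum by (rule sum.cong) (use that in \<open>auto simp: polyL\<close>)
        with that assms(1) show ?thesis by simp
      qed
      show "degree (\<Sum>a\<in>A. smult (poly H a) (L a)) < card A"
        by (rule degree_sum_less) (use card_pos degL in \<open>auto intro: le_less_trans[OF degree_smult_le]\<close>)
    qed (fact that)
    then have "poly (\<Sum>a\<in>A. smult (poly H a) (L a)) 0 = poly H 0" by simp
    then show ?thesis
      by (simp add: poly_sum c_def mult.commute)
  qed
  show "(\<Sum>a\<in>A. c a * a ^ k) = 0 ^ k" if "k < card A" for k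
    using interp[of "monom 1 k"] that by (simp add: degree_monom_eq poly_monom)
  \<comment> \<open>Subtracting \<open>Q\<close> brings \<open>x ^ card A\<close> down into the
    interpolation range without changing its values on \<open>A\<close>. The moment of order
    \<open>card A\<close> is therefore \<open>- poly Q 0\<close>, nonzero because 0 is not in
    \<open>A\<close>.\<close>
  define Q where "Q = (\<Prod>a\<in>A. [:-a, 1:])"
  have degQ: "degree Q = card A"
    unfolding Q_def by (subst degree_prod_eq_sum_degree) auto
  have leadQ: "coeff Q (card A) = 1"
    using lead_coeff_prod[of "\<lambda>a. [:-a, 1:]" A] by (simp add: Q_def[symmetric] degQ)
  have "degree (monom 1 (card A) - Q) < card A"
  proof (intro degree_lessI allI impI)
    fix k assume "k \<ge> card A"
    then show "coeff (monom 1 (card A) - Q) k = 0"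
      using leadQ degQ by (cases "k = card A") (auto simp: coeff_eq_0)
  qed (use card_pos in auto)
  from interp[OF this] have "(\<Sum>a\<in>A. c a * (a ^ card A - poly Q a)) = 0 ^ card A - poly Q 0"
    by (simp add: poly_monom)
  moreover have "poly Q a = 0" if "a \<in> A" for a
    using that assms(1) by (auto simp: Q_def poly_prod)
  ultimately have "(\<Sum>a\<in>A. c a * a ^ card A) = - poly Q 0"
    using card_pos by simp
  moreover have "poly Q 0 \<noteq> 0"
    using assms by (auto simp: Q_def poly_prod)
  ultimately show "(\<Sum>a\<in>A. c a * a ^ card A) \<noteq> 0" by simp
qed

text \<open>The outer variable stands for the parameter \<open>a\<close>, the coefficients are
  polynomials in \<open>x\<close>. Weighting a family of degree below \<open>s\<close> in
  \<open>a\<close> thus amounts to setting \<open>a\<close> to 0.\<close>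

lemma interpolation_weights_poly_poly:
  fixes c :: "'a::field \<Rightarrow> 'a" and H :: "'a poly poly"
  assumes "\<And>k. k < s \<Longrightarrow> (\<Sum>a\<in>A. c a * a ^ k) = 0 ^ k" and "degree H < s"
  shows "(\<Sum>a\<in>A. smult (c a) (poly H [:a:])) = poly H 0"
proof -
  have "(\<Sum>a\<in>A. smult (c a) (poly H [:a:])) = (\<Sum>a\<in>A. \<Sum>k\<le>degree H. smult (c a * a ^ k) (coeff H k))"
  proof (rule sum.cong)
    fix a
    have "smult (c a) (poly H [:a:]) = [:c a:] * (\<Sum>k\<le>degree H. smult (a ^ k) (coeff H k))"
      by (simp add: poly_altdef poly_const_pow)
    then show "smult (c a) (poly H [:a:]) = (\<Sum>k\<le>degree H. smult (c a * a ^ k) (coeff H k))"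
      unfolding sum_distrib_left by (simp add: mult.commute)
  qed simp
  also have "\<dots> = (\<Sum>k\<le>degree H. smult (\<Sum>a\<in>A. c a * a ^ k) (coeff H k))"
    by (subst sum.swap) (simp add: smult_sum)
  also have "\<dots> = (\<Sum>k\<le>degree H. if k = 0 then coeff H k else 0)"
    by (rule sum.cong) (use assms in auto)
  also have "\<dots> = poly H 0"
    by (simp add: poly_0_coeff_0)
  finally show ?thesis .
qed

section \<open>Auxiliary polynomials\<close>

text \<open>For \<open>e = 1\<close> Frobenius turns the difference into
  \<open>a ^ s * (x - b) ^ s\<close>; in general \<open>u - v\<close> divides
  \<open>u ^ e - v ^ e\<close>.\<close>

lemma linear_power_dvd_diff:
  fixes a b l :: "'a::field"
  assumes "prime CHAR('a)" and "s = CHAR('a) ^ m"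
  shows "[:-b, 1:] ^ s dvd [:l, a:] ^ (s * e) - [:(a * b + l) ^ (s * e):]"
proof -
  have "[:l, a:] ^ s - [:a * b + l:] ^ s = ([:l, a:] - [:a * b + l:]) ^ s"
    using diff_power_prime_power[of s m "[:l, a:]" "[:a * b + l:]"] assms by simp
  also have "[:l, a:] - [:a * b + l:] = smult a [:-b, 1:]"
    by simp
  finally have "[:-b, 1:] ^ s dvd [:l, a:] ^ s - [:a * b + l:] ^ s"
    by (metis dvd_refl dvd_smult smult_power)
  also have "\<dots> dvd ([:l, a:] ^ s) ^ e - ([:a * b + l:] ^ s) ^ e"
    by (simp add: power_diff_sumr2)
  finally show ?thesis
    by (simp add: power_mult poly_const_pow)
qed

lemma strong_set_conjugate_bound:
  fixes A :: "'a::field set"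
  assumes "prime CHAR('a)" and s: "s = CHAR('a) ^ m"
    and A: "card A = s" "0 \<notin> A" and "l \<noteq> 0"
    and conj: "\<And>a b. a \<in> A \<Longrightarrow> b \<in> A \<Longrightarrow> (a * b + l) ^ (s * e) = (a * b + l) ^ M"
    and "M < s" and "of_nat e \<noteq> (0::'a)"
  shows "s \<le> e"
proof -
  have "s > 0" using s assms(1) prime_gt_0_nat by simp
  with A have A': "finite A" "A \<noteq> {}" using card_gt_0_iff by metis+
  from A A' obtain c where c: "\<And>k. k < s \<Longrightarrow> (\<Sum>a\<in>A. c a * a ^ k) = 0 ^ k"
    and cs: "(\<Sum>a\<in>A. c a * a ^ s) \<noteq> 0"
    using interpolation_weights_at_0[of A] by metis
  define f where "f = (\<Sum>a\<in>A. smult (c a) ([:l, a:] ^ (s * e))) - [:l ^ M:]"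
  have coeff_f: "coeff ([:l, a:] ^ (s * e)) s = of_nat e * a ^ s * (l ^ s) ^ (e - 1)" for a
    using coeff_linear_power_mult_prime_power[OF assms(1) s, of 1 0 l a e 1] \<open>s > 0\<close> by simp
  have "coeff f s = of_nat e * (l ^ s) ^ (e - 1) * (\<Sum>a\<in>A. c a * a ^ s)"
    using \<open>s > 0\<close> unfolding sum_distrib_left
    by (auto simp: f_def coeff_sum coeff_f coeff_pCons' intro!: sum.cong)
  with cs \<open>of_nat e \<noteq> 0\<close> \<open>l \<noteq> 0\<close> have "coeff f s \<noteq> 0" by simp
  then have "f \<noteq> 0" by auto
  have "[:-b, 1:] ^ s dvd f" if b: "b \<in> A" for b
  proof -
    have "(\<Sum>a\<in>A. smult (c a) [:(a * b + l) ^ (s * e):]) = [:l ^ M:]"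
    proof -
      \<comment> \<open>This is \<open>(l + b a) ^ M\<close> as a polynomial in the outer variable
        \<open>a\<close>; \<open>M < s\<close> keeps it within the range of the weights.\<close>
      define H where "H = [:[:l:], [:b:]:] ^ M"
      have "degree H \<le> M"
        unfolding H_def using degree_power_le[of "[:[:l:], [:b:]:]" M] by (rule order.trans) simp
      then have "(\<Sum>a\<in>A. smult (c a) (poly H [:a:])) = poly H 0"
        using \<open>M < s\<close> by (intro interpolation_weights_poly_poly[OF c]) auto
      moreover have "poly H [:a:] = [:(a * b + l) ^ (s * e):]" if "a \<in> A" for a
        using conj[OF that b] by (simp add: H_def poly_const_pow add.commute mult.commute)
      ultimately show ?thesis
        by (simp add: H_def poly_const_pow)
    qed
    then have "f = (\<Sum>a\<in>A. smult (c a) ([:l, a:] ^ (s * e) - [:(a * b + l) ^ (s * e):]))"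
      unfolding f_def by (simp add: smult_diff_right sum_subtractf)
    then show ?thesis
      using linear_power_dvd_diff[OF assms(1) s] by (auto intro!: dvd_sum dvd_smult)
  qed
  then have "(\<Prod>a\<in>A. [:-a, 1:]) ^ s dvd f"
    using A' by (intro prod_linear_power_dvd)
  then have "degree ((\<Prod>a\<in>A. [:-a, 1:]) ^ s) \<le> degree f"
    using \<open>f \<noteq> 0\<close> by (rule dvd_imp_degree_le)
  moreover have "degree ((\<Prod>a\<in>A. [:-a, 1:]) ^ s) = s * s"
    using A A' by (simp add: degree_power_eq degree_prod_eq_sum_degree)
  moreover have "degree f \<le> s * e"
  proof -
    have "degree ([:l, a:] ^ (s * e)) \<le> s * e" for a
      using degree_power_le[of "[:l, a:]" "s * e"] by (rule order.trans) auto
    then show ?thesis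
      unfolding f_def
      by (intro degree_diff_le degree_sum_le A' order.trans[OF degree_smult_le]) auto
  qed
  ultimately have "s * s \<le> s * e" by linarith
  with \<open>s > 0\<close> show ?thesis by simp
qed

text \<open>The factor \<open>(x - a) ^ v\<close> supplies the zero at \<open>b = a\<close>, where
  nothing is known about \<open>a * b + l\<close>. It adds \<open>v\<close> to the degree in
  \<open>a\<close>, and \<open>M + v < s\<close> leaves room for that.\<close>

lemma conjugate_auxiliary_poly:
  fixes A :: "'a::field set" and c :: "'a \<Rightarrow> 'a"
  assumes "prime CHAR('a)" and s: "s = CHAR('a) ^ m"
    and A: "finite A" "card A = s"
    and c: "\<And>k. k < s \<Longrightarrow> (\<Sum>a\<in>A. c a * a ^ k) = 0 ^ k"
    and conj: "\<And>a b. a \<in> A \<Longrightarrow> b \<in> A \<Longrightarrow> a \<noteq> b \<Longrightarrow> (a * b + l) ^ (s * e) = (a * b + l) ^ M"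
    and Mv: "s = M + v + 1"
  defines "f \<equiv> (\<Sum>a\<in>A. smult (c a) ([:l, a:] ^ (s * e) * [:-a, 1:] ^ v)) - monom (l ^ M) v"
  shows "(\<Prod>a\<in>insert 0 A. [:-a, 1:]) ^ v dvd f" and "degree f \<le> s * e + v"
proof -
  have lin: "[:-b, 1:] ^ v dvd [:l, a:] ^ (s * e) - [:(a * b + l) ^ (s * e):]" for a b
    using linear_power_dvd_diff[OF assms(1) s] Mv by (meson dvd_trans le_add2 le_imp_power_dvd trans_le_add1)
  have weights: "(\<Sum>a\<in>A. smult (c a) ([:t * (a * b + l) ^ K:] * [:-a, 1:] ^ v)) = monom (t * l ^ K) v"
    if "K + v < s" for b t K
  proof -
    \<comment> \<open>In the outer variable this is \<open>t (l + b a) ^ K (x - a) ^ v\<close>. It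
      serves both the points of \<open>A\<close> (with \<open>K = M\<close>) and the point 0 (with
      \<open>K = 0\<close>).\<close>
    define H where "H = smult [:t:] ([:[:l:], [:b:]:] ^ K * [:[:0, 1:], -1:] ^ v)"
    have "degree ([:[:l:], [:b:]:] ^ K * [:[:0, 1:], -1:] ^ v) \<le> K * 1 + v * 1"
      unfolding H_def
      by (rule order.trans[OF degree_mult_le] add_mono order.trans[OF degree_power_le])+ auto
    then have "degree H < s"
      using that order.strict_trans1[OF degree_smult_le] by (auto simp: H_def)
    then have "(\<Sum>a\<in>A. smult (c a) (poly H [:a:])) = poly H 0"
      by (intro interpolation_weights_poly_poly[OF c]) auto
    then show ?thesis
      by (simp add: H_def poly_const_pow monom_altdef add.commute mult.commute)
  qed
  have "[:-b, 1:] ^ v dvd f" if b: "b \<in> A" for b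
  proof -
    have "f = (\<Sum>a\<in>A. smult (c a) (([:l, a:] ^ (s * e) - [:(a * b + l) ^ M:]) * [:-a, 1:] ^ v))"
      unfolding f_def using weights[of M 1 b] Mv
      by (simp add: left_diff_distrib smult_diff_right sum_subtractf)
    moreover have "[:-b, 1:] ^ v dvd ([:l, a:] ^ (s * e) - [:(a * b + l) ^ M:]) * [:-a, 1:] ^ v"
      if "a \<in> A" for a
      using lin[of b a] conj[OF that b] by (cases "a = b") auto
    ultimately show ?thesis
      by (auto intro!: dvd_sum dvd_smult)
  qed
  moreover have "[:0, 1:] ^ v dvd f"
  proof -
    \<comment> \<open>At 0 the constant \<open>l ^ (s * e)\<close> is subtracted instead; its
      weighted contribution is only a multiple of \<open>x ^ v\<close>, so 0 is an additional zero
      of order \<open>v\<close>.\<close>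
    have "f = (\<Sum>a\<in>A. smult (c a) (([:l, a:] ^ (s * e) - [:l ^ (s * e):]) * [:-a, 1:] ^ v))
        + smult (l ^ (s * e) - l ^ M) (monom 1 v)"
      unfolding f_def using weights[of 0 "l ^ (s * e)" 0] Mv
      by (simp add: left_diff_distrib smult_diff_right sum_subtractf smult_monom minus_monom flip: diff_monom)
    moreover have "[:0, 1:] ^ v dvd ([:l, a:] ^ (s * e) - [:l ^ (s * e):]) * [:-a, 1:] ^ v" for a
      using lin[of 0 a] by auto
    ultimately show ?thesis
      by (auto intro!: dvd_sum dvd_add dvd_smult simp: monom_altdef)
  qed
  ultimately have "[:-b, 1:] ^ v dvd f" if "b \<in> insert 0 A" for b
    using that by auto
  then show "(\<Prod>a\<in>insert 0 A. [:-a, 1:]) ^ v dvd f"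
    using A by (intro prod_linear_power_dvd) auto
  have "degree ([:l, a:] ^ (s * e) * [:-a, 1:] ^ v) \<le> s * e + v" for a
  proof -
    have "degree ([:l, a:] ^ (s * e)) \<le> s * e"
      using degree_power_le[of "[:l, a:]" "s * e"] by (rule order.trans) auto
    then show ?thesis
      by (intro order.trans[OF degree_mult_le]) (simp add: degree_linear_power)
  qed
  then show "degree f \<le> s * e + v"
    unfolding f_def
    by (intro degree_diff_le degree_sum_le A order.trans[OF degree_smult_le] order.trans[OF degree_monom_le]) auto
qed

lemma degree_prod_linear_insert_0:
  fixes A :: "'a::field set"
  assumes "finite A" and "0 \<notin> A"
  shows "degree ((\<Prod>a\<in>insert 0 A. [:-a, 1:]) ^ n) = (card A + 1) * n"
proof -
  have "degree (\<Prod>a\<in>insert 0 A. [:-a, 1:]) = card A + 1"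
    using assms by (subst degree_prod_eq_sum_degree) auto
  moreover have "(\<Prod>a\<in>insert 0 A. [:-a, 1:]) \<noteq> 0"
    using assms(1) by (subst prod_zero_iff) auto
  ultimately show ?thesis
    by (simp add: degree_power_eq mult.commute del: prod.insert)
qed

text \<open>There are \<open>s + 1\<close> zeros of order \<open>v\<close> against degree at most
  \<open>s * e + v\<close>. The coefficient at \<open>x ^ (s + v)\<close> shows \<open>f\<close>
  nonzero: there the leading term of \<open>(x - a) ^ v\<close> meets the term \<open>x ^ s\<close>
  of the linear power.\<close>

lemma set_conjugate_bound:
  fixes A :: "'a::field set"
  assumes "prime CHAR('a)" and s: "s = CHAR('a) ^ m"
    and A: "card A = s" "0 \<notin> A" and "l \<noteq> 0"
    and conj: "\<And>a b. a \<in> A \<Longrightarrow> b \<in> A \<Longrightarrow> a \<noteq> b \<Longrightarrow> (a * b + l) ^ (s * e) = (a * b + l) ^ M"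
    and Mv: "s = M + v + 1" and "of_nat e \<noteq> (0::'a)"
  shows "v \<le> e"
proof -
  have "s > 0" using Mv by simp
  with A have A': "finite A" "A \<noteq> {}" using card_gt_0_iff by metis+
  from A A' obtain c where c: "\<And>k. k < s \<Longrightarrow> (\<Sum>a\<in>A. c a * a ^ k) = 0 ^ k"
    and cs: "(\<Sum>a\<in>A. c a * a ^ s) \<noteq> 0"
    using interpolation_weights_at_0[of A] by metis
  define f where "f = (\<Sum>a\<in>A. smult (c a) ([:l, a:] ^ (s * e) * [:-a, 1:] ^ v)) - monom (l ^ M) v"
  have coeff_f: "coeff ([:l, a:] ^ (s * e) * [:-a, 1:] ^ v) (s + v) = of_nat e * a ^ s * (l ^ s) ^ (e - 1)" for a
    using coeff_linear_power_mult_prime_power[OF assms(1) s, of "[:-a, 1:] ^ v" v l a e 1] Mv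
    by (simp add: degree_linear_power coeff_linear_power)
  have "coeff f (s + v) = of_nat e * (l ^ s) ^ (e - 1) * (\<Sum>a\<in>A. c a * a ^ s)"
    using \<open>s > 0\<close> unfolding sum_distrib_left
    by (auto simp: f_def coeff_sum coeff_f intro!: sum.cong)
  with cs \<open>of_nat e \<noteq> 0\<close> \<open>l \<noteq> 0\<close> have "coeff f (s + v) \<noteq> 0" by simp
  then have "f \<noteq> 0" by auto
  note aux = conjugate_auxiliary_poly[OF assms(1) s A'(1) A(1) c conj Mv, folded f_def]
  have "s * v + v \<le> degree f"
    using dvd_imp_degree_le[OF aux(1) \<open>f \<noteq> 0\<close>] degree_prod_linear_insert_0[OF A'(1) A(2)] A(1) by (simp add: add.commute)
  with aux(2) have "s * v \<le> s * e" by linarith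
  with \<open>s > 0\<close> show ?thesis by simp
qed

text \<open>With \<open>s = 5\<close> and \<open>e = v = 2\<close> the previous count is an
  equality, so \<open>f\<close> is a constant times the square of \<open>x Q\<close>. The
  coefficients of \<open>f\<close> then force \<open>Q\<close> to be \<open>x ^ 5 + p0\<close>,
  which has a single root in characteristic 5.\<close>

lemma card_5_not_conjugate_squares:
  fixes A :: "'a::field set"
  assumes char: "CHAR('a) = 5" and A: "card A = 5" "0 \<notin> A" and "l \<noteq> 0"
    and conj: "\<And>a b. a \<in> A \<Longrightarrow> b \<in> A \<Longrightarrow> a \<noteq> b \<Longrightarrow> (a * b + l) ^ 10 = (a * b + l) ^ 2"
  shows False
proof -
  have five: "prime CHAR('a)" "5 = CHAR('a) ^ 1" using char by simp_all
  have nz: "(2::'a) \<noteq> 0"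
    using of_nat_eq_0_iff_char_dvd[of 2, where ?'a = 'a] char by simp
  from A have A': "finite A" "A \<noteq> {}" using card_gt_0_iff[of A] by auto
  from A A' obtain c where c: "\<And>k. k < 5 \<Longrightarrow> (\<Sum>a\<in>A. c a * a ^ k) = 0 ^ k"
    and cs: "(\<Sum>a\<in>A. c a * a ^ 5) \<noteq> 0"
    using interpolation_weights_at_0[of A] by metis
  define T where "T k = (\<Sum>a\<in>A. c a * a ^ k)" for k
  define f where "f = (\<Sum>a\<in>A. smult (c a) ([:l, a:] ^ (5 * 2) * [:-a, 1:] ^ 2)) - monom (l ^ 2) 2"
  have coeff_f: "coeff f (5 * j + k) =
      of_nat (2 choose j) * (l ^ 5) ^ (2 - j) * (\<Sum>a\<in>A. c a * ((a ^ 5) ^ j * coeff ([:-a, 1:] ^ 2) k))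
      - (if 5 * j + k = 2 then l ^ 2 else 0)" if "k < 5" for j k
  proof -
    have "coeff ([:l, a:] ^ (5 * 2) * [:-a, 1:] ^ 2) (5 * j + k) =
      of_nat (2 choose j) * (a ^ 5) ^ j * (l ^ 5) ^ (2 - j) * coeff ([:-a, 1:] ^ 2) k" for a
      using coeff_linear_power_mult_prime_power[OF five, of "[:-a, 1:] ^ 2" k l a 2 j] that
      by (simp add: degree_linear_power)
    then show ?thesis
      unfolding sum_distrib_left by (auto simp: f_def coeff_sum intro!: sum.cong)
  qed
  have conj': "(a * b + l) ^ (5 * 2) = (a * b + l) ^ 2" if "a \<in> A" "b \<in> A" "a \<noteq> b" for a b
    using conj[OF that] by simp
  have "5 = 2 + 2 + (1::nat)" by simp
  then have aux: "(\<Prod>a\<in>insert 0 A. [:-a, 1:]) ^ 2 dvd f" "degree f \<le> 5 * 2 + 2"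
    using conjugate_auxiliary_poly[OF five A'(1) A(1) c conj'] unfolding f_def by blast+
  define Q where "Q = (\<Prod>a\<in>A. [:-a, 1:])"
  have degQ: "degree Q = 5"
    unfolding Q_def using A by (subst degree_prod_eq_sum_degree) auto
  have leadQ: "coeff Q 5 = 1"
    using lead_coeff_prod[of "\<lambda>a. [:-a, 1:]" A] by (simp add: Q_def[symmetric] degQ)
  obtain p0 p1 p2 p3 p4 where Q: "Q = [:p0, p1, p2, p3, p4, 1:]"
  proof
    show "Q = [:coeff Q 0, coeff Q 1, coeff Q 2, coeff Q 3, coeff Q 4, 1:]"
    proof (rule poly_eqI)
      fix n :: nat
      consider "n = 0" | "n = 1" | "n = 2" | "n = 3" | "n = 4" | "n = 5" | "n > 5" by linarith
      then show "coeff Q n = coeff [:coeff Q 0, coeff Q 1, coeff Q 2, coeff Q 3, coeff Q 4, 1:] n"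
        using leadQ degQ by cases (auto simp: coeff_pCons' coeff_eq_0)
    qed
  qed
  have "p0 \<noteq> 0"
  proof -
    have "poly Q 0 \<noteq> 0" using A A' by (auto simp: Q_def poly_prod)
    then show ?thesis by (simp add: Q)
  qed
  have sq: "[:-a, 1:] ^ 2 = [:a ^ 2, - 2 * a, 1::'a:]" for a
    by (simp add: power2_eq_square)
  \<comment> \<open>Exponents congruent to 3 or 4 modulo 5 do not occur, because
    \<open>(x - a) ^ 2\<close> fills only the first three places of each block.\<close>
  have f3: "coeff f 3 = 0" and f4: "coeff f 4 = 0" and f5: "coeff f 5 = 2 * l ^ 5 * T 7"
    and f7: "coeff f 7 = 2 * l ^ 5 * T 5" and f8: "coeff f 8 = 0"
  proof -
    have cf: "coeff [:x, y, 1::'a:] 3 = 0" "coeff [:x, y, 1::'a:] 4 = 0" "coeff [:x, y, 1::'a:] 2 = 1" for x y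
      by (simp_all add: coeff_pCons')
    have "a ^ 7 = a ^ 5 * a ^ 2" for a :: 'a
      by (simp flip: power_add)
    then have T7: "T 7 = (\<Sum>a\<in>A. c a * (a ^ 5 * a ^ 2))"
      by (simp only: T_def)
    show "coeff f 3 = 0" using coeff_f[of 3 0] by (simp add: sq cf)
    show "coeff f 4 = 0" using coeff_f[of 4 0] by (simp add: sq cf)
    show "coeff f 5 = 2 * l ^ 5 * T 7" using coeff_f[of 0 1] unfolding T7 by (simp add: sq)
    show "coeff f 7 = 2 * l ^ 5 * T 5" using coeff_f[of 2 1] by (simp add: sq cf T_def)
    show "coeff f 8 = 0" using coeff_f[of 3 1] by (simp add: sq cf)
  qed
  from f7 cs nz \<open>l \<noteq> 0\<close> have "f \<noteq> 0" by (auto simp: T_def)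
  have W: "(\<Prod>a\<in>insert 0 A. [:-a, 1:]) = [:0, p0, p1, p2, p3, p4, 1:]"
    using A A' by (simp add: Q_def[symmetric] Q)
  have "[:0, p0, p1, p2, p3, p4, 1:] ^ 2 dvd f"
    using aux(1) unfolding W .
  then obtain g where g: "f = [:0, p0, p1, p2, p3, p4, 1:] ^ 2 * g" by (auto elim: dvdE)
  with \<open>f \<noteq> 0\<close> have "degree f = 12 + degree g"
    by (auto simp: degree_mult_eq degree_power_eq)
  with aux(2) have "degree g = 0" by simp
  then obtain C where C: "g = [:C:]" by (auto elim: degree_eq_zeroE)
  with g \<open>f \<noteq> 0\<close> have "C \<noteq> 0" by auto
  have f_eq: "f = smult C [:0, 0, p0 * p0, 2 * p0 * p1, 2 * p0 * p2 + p1 * p1, 2 * p0 * p3 + 2 * p1 * p2,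
    2 * p0 * p4 + 2 * p1 * p3 + p2 * p2, 2 * p0 + 2 * p1 * p4 + 2 * p2 * p3, 2 * p1 + 2 * p2 * p4 + p3 * p3,
    2 * p2 + 2 * p3 * p4, 2 * p3 + p4 * p4, 2 * p4, 1:]"
    unfolding g C by (simp add: power2_eq_square algebra_simps)
  have "p1 = 0"
    using f3 \<open>C \<noteq> 0\<close> nz \<open>p0 \<noteq> 0\<close> unfolding f_eq by (simp add: coeff_pCons')
  moreover from this have "p2 = 0"
    using f4 \<open>C \<noteq> 0\<close> nz \<open>p0 \<noteq> 0\<close> unfolding f_eq by (simp add: coeff_pCons')
  moreover from calculation have "p3 = 0"
    using f8 \<open>C \<noteq> 0\<close> unfolding f_eq by (simp add: coeff_pCons')
  ultimately have p: "p1 = 0" "p2 = 0" "p3 = 0" by auto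
  have "T 7 = 0"
    using f5 p nz \<open>l \<noteq> 0\<close> unfolding f_eq by (simp add: coeff_pCons')
  have a5: "a ^ 5 = - p4 * a ^ 4 - p0" if "a \<in> A" for a
  proof -
    have "poly Q a = 0" using that A' by (auto simp: Q_def poly_prod)
    then show ?thesis
      unfolding Q p by (simp add: algebra_simps eval_nat_numeral eq_neg_iff_add_eq_0)
  qed
  have rec: "T (5 + k) = - p4 * T (4 + k) - p0 * T k" for k
  proof -
    have "T (5 + k) = (\<Sum>a\<in>A. - p4 * (c a * a ^ (4 + k)) - p0 * (c a * a ^ k))"
      unfolding T_def by (rule sum.cong) (auto simp: power_add a5 algebra_simps)
    then show ?thesis
      by (simp add: T_def sum_subtractf sum_distrib_left)
  qed
  have "p4 = 0"
  proof -
    \<comment> \<open>From these values the recursion yields successively \<open>T 5 = - p0\<close>,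
      \<open>T 6 = p4 * p0\<close> and \<open>T 7 = - (p4 * p4 * p0)\<close>.\<close>
    have T: "T 0 = 1" "T (Suc 0) = 0" "T 2 = 0" "T 4 = 0"
      using c[of 0] c[of 1] c[of 2] c[of 4] by (simp_all add: T_def)
    have "T 7 = - (p4 * p4 * p0)"
      using rec[of 0] rec[of 1] rec[of 2] by (simp add: T)
    with \<open>T 7 = 0\<close> \<open>p0 \<noteq> 0\<close> show ?thesis by simp
  qed
  have "a = b" if "a \<in> A" "b \<in> A" for a b
  proof -
    have "(a - b) ^ 5 = 0"
      using diff_power_prime_power[OF five, of a b] a5[OF that(1)] a5[OF that(2)] \<open>p4 = 0\<close> by simp
    then show ?thesis by simp
  qed
  then have "card A \<le> 1"
    using A' by (simp add: card_le_Suc0_iff_eq)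
  with A show False by simp
qed

lemma stepanov_off_diagonal:
  fixes A :: "'a::field set"
  assumes A: "card A = s" "0 \<notin> A" and "l \<noteq> 0" and "N > 0"
    and res: "\<And>a b. a \<in> A \<Longrightarrow> b \<in> A \<Longrightarrow> a \<noteq> b \<Longrightarrow> a * b + l = 0 \<or> (a * b + l) ^ N = 1"
    and s: "s = K + L + 1" and \<mu>: "\<mu> \<le> K" "\<mu> \<le> L" and "L \<noteq> K + 1"
    and bin: "of_nat ((N + K) choose (K + 1)) \<noteq> (0::'a)"
  shows "(s + 1) * \<mu> < N + s"
proof -
  have "s > 0" using s by simp
  with A have A': "finite A" "A \<noteq> {}" using card_gt_0_iff by metis+
  from A A' obtain c where c: "\<And>k. k < s \<Longrightarrow> (\<Sum>a\<in>A. c a * a ^ k) = 0 ^ k"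
    and cs: "(\<Sum>a\<in>A. c a * a ^ s) \<noteq> 0"
    using interpolation_weights_at_0[of A] by metis
  have weights: "(\<Sum>a\<in>A. smult (c a) (poly G [:a:] * [:-a, 1:] ^ L)) = poly G 0 * [:0, 1:] ^ L"
    if "degree G \<le> K" for G
  proof -
    define H where "H = G * [:[:0, 1:], -1:] ^ L"
    have "degree H \<le> K + L * 1"
      unfolding H_def using that
      by (intro order.trans[OF degree_mult_le] add_mono order.trans[OF degree_power_le]) auto
    then have "(\<Sum>a\<in>A. smult (c a) (poly H [:a:])) = poly H 0"
      using s by (intro interpolation_weights_poly_poly[OF c]) auto
    then show ?thesis
      by (simp add: H_def)
  qed
  define f where "f = (\<Sum>a\<in>A. smult (c a) ([:l, a:] ^ (N + K) * [:-a, 1:] ^ L)) - smult (l ^ K) ([:0, 1:] ^ L)"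
  have expand: "[:l, a:] ^ (N + K) =
      (\<Sum>k\<le>N + K. smult (of_nat ((N + K) choose k) * a ^ k * (a * b + l) ^ (N + K - k)) ([:-b, 1:] ^ k))" for a b
  proof -
    have "[:l, a:] = smult a [:-b, 1:] + [:a * b + l:]" by simp
    then have "[:l, a:] ^ (N + K) = (smult a [:-b, 1:] + [:a * b + l:]) ^ (N + K)" by metis
    moreover have "(smult a X + [:z:]) ^ n =
        (\<Sum>k\<le>n. smult (of_nat (n choose k) * a ^ k * z ^ (n - k)) (X ^ k))" for X and z :: 'a and n
      by (simp add: binomial_ring smult_power poly_const_pow of_nat_poly mult_ac)
    ultimately show ?thesis by (simp only:)
  qed
  have dvd_A: "[:-b, 1:] ^ \<mu> dvd f" if b: "b \<in> A" for b
  \<comment> \<open>For \<open>K = 0\<close> the truncated expansion \<open>G\<close> would be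
    empty, but then \<open>\<mu> = 0\<close> and the claim is trivial.\<close>
  proof (cases "K = 0")
    case False
    define G where "G = (\<Sum>k<K. smult (smult (of_nat ((N + K) choose k)) ([:-b, 1:] ^ k))
      (monom 1 k * [:[:l:], [:b:]:] ^ (K - k)))"
    have deg: "degree (smult x (monom 1 k * [:[:l:], [:b:]:] ^ (K - k))) \<le> K" if "k < K" for k and x :: "'a poly"
    proof -
      have "degree (monom 1 k * [:[:l:], [:b:]:] ^ (K - k)) \<le> k + 1 * (K - k)"
        by (intro order.trans[OF degree_mult_le] add_mono degree_monom_le order.trans[OF degree_power_le]) auto
      with that show ?thesis
        by (intro order.trans[OF degree_smult_le]) auto
    qed
    have "degree G \<le> K"
      unfolding G_def by (intro degree_sum_le deg) auto
    moreover have "poly G 0 = [:l ^ K:]"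
    proof -
      have "poly G 0 = (\<Sum>k<K. if k = 0 then [:l ^ K:] else 0)"
        unfolding G_def poly_sum by (rule sum.cong) (auto simp: poly_monom poly_const_pow)
      with False show ?thesis by simp
    qed
    ultimately have "f = (\<Sum>a\<in>A. smult (c a) (([:l, a:] ^ (N + K) - poly G [:a:]) * [:-a, 1:] ^ L))"
      unfolding f_def using weights[of G]
      by (simp add: left_diff_distrib smult_diff_right sum_subtractf)
    moreover have "[:-b, 1:] ^ \<mu> dvd ([:l, a:] ^ (N + K) - poly G [:a:]) * [:-a, 1:] ^ L"
      if a: "a \<in> A" for a
    proof (cases "a = b")
      case True
      with \<mu>(2) show ?thesis by (simp add: le_imp_power_dvd dvd_mult)
    next
      case False
      let ?t = "\<lambda>k. smult (of_nat ((N + K) choose k) * a ^ k * (a * b + l) ^ (N + K - k)) ([:-b, 1:] ^ k)"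
      have "poly G [:a:] = (\<Sum>k<K. ?t k)"
        unfolding G_def poly_sum
      proof (rule sum.cong)
        fix k assume "k \<in> {..<K}"
        then have "k < K" by simp
        then have e: "N + K - k = N + (K - k)" "K - k > 0" by simp_all
        have "(a * b + l) ^ (N + K - k) = (a * b + l) ^ (K - k)"
          using res[OF a b False] e(2) unfolding e(1) power_add by auto
        then show "poly (smult (smult (of_nat ((N + K) choose k)) ([:-b, 1:] ^ k))
            (monom 1 k * [:[:l:], [:b:]:] ^ (K - k))) [:a:] = ?t k"
          by (simp add: poly_monom poly_const_pow mult_ac add_ac)
      qed simp
      moreover have "[:l, a:] ^ (N + K) = (\<Sum>k<K. ?t k) + (\<Sum>k=K..N + K. ?t k)"
      proof -
        have "{..N + K} = {..<K} \<union> {K..N + K}" by auto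
        then show ?thesis
          unfolding expand[of a b] by (simp only:) (rule sum.union_disjoint; auto)
      qed
      ultimately have "[:l, a:] ^ (N + K) - poly G [:a:] = (\<Sum>k=K..N + K. ?t k)"
        by simp
      moreover have "[:-b, 1:] ^ \<mu> dvd (\<Sum>k=K..N + K. ?t k)"
        using \<mu>(1) by (intro dvd_sum dvd_smult le_imp_power_dvd) auto
      ultimately show ?thesis by simp
    qed
    ultimately show ?thesis
      by (auto intro!: dvd_sum dvd_smult)
  qed (use \<mu> in auto)
  \<comment> \<open>The tail of the expansion at 0; the terms of order at most \<open>K\<close> are
    within reach of the weights and leave only a multiple of \<open>x ^ L\<close>.\<close>
  define R where "R a = (\<Sum>k=K + 1..N + K. monom (of_nat ((N + K) choose k) * a ^ k * l ^ (N + K - k)) k)" for a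
  have f_eq: "f = (\<Sum>a\<in>A. smult (c a) (R a * [:-a, 1:] ^ L)) + smult (l ^ (N + K) - l ^ K) ([:0, 1:] ^ L)"
  proof -
    define G where "G = (\<Sum>k\<le>K. monom (monom (of_nat ((N + K) choose k) * l ^ (N + K - k)) k) k)"
    have "degree G \<le> K"
      unfolding G_def by (intro degree_sum_le order.trans[OF degree_monom_le]) auto
    moreover have "poly G 0 = [:l ^ (N + K):]"
    proof -
      have "poly G 0 = (\<Sum>k\<le>K. if k = 0 then [:l ^ (N + K):] else 0)"
        unfolding G_def poly_sum by (rule sum.cong) (auto simp: poly_monom monom_0)
      then show ?thesis by simp
    qed
    moreover have "[:l, a:] ^ (N + K) = R a + poly G [:a:]" for a
    proof -
      let ?t = "\<lambda>k. monom (of_nat ((N + K) choose k) * a ^ k * l ^ (N + K - k)) k"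
      have "{..N + K} = {..K} \<union> {K + 1..N + K}" by auto
      then have "(\<Sum>k\<le>N + K. ?t k) = (\<Sum>k\<le>K. ?t k) + (\<Sum>k=K + 1..N + K. ?t k)"
        by (simp only:) (rule sum.union_disjoint; auto)
      moreover have "[:l, a:] ^ (N + K) = (\<Sum>k\<le>N + K. ?t k)"
        unfolding expand[of a 0] by (simp add: monom_altdef)
      moreover have "poly G [:a:] = (\<Sum>k\<le>K. ?t k)"
        by (simp add: G_def poly_sum poly_monom poly_const_pow smult_monom mult_ac)
      ultimately show ?thesis
        by (simp add: R_def)
    qed
    ultimately show ?thesis
      unfolding f_def using weights[of G]
      by (simp add: distrib_right smult_add_right sum.distrib smult_diff_left)
  qed
  have R_low: "coeff (R a) k = (if k = K + 1 then of_nat ((N + K) choose (K + 1)) * a ^ (K + 1) * l ^ (N - 1) else 0)"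
    if "k \<le> K + 1" for a k
    using that \<open>N > 0\<close> by (auto simp: R_def coeff_sum)
  have dvd_0: "[:0, 1:] ^ \<mu> dvd f"
  proof -
    have "[:0, 1:] ^ \<mu> dvd R a" for a
      unfolding R_def using \<mu>(1) by (auto intro!: dvd_sum dvd_smult le_imp_power_dvd simp: monom_altdef)
    moreover have "[:0, 1::'a:] ^ \<mu> dvd [:0, 1:] ^ L"
      using \<mu>(2) by (rule le_imp_power_dvd)
    ultimately show ?thesis
      unfolding f_eq by (intro dvd_add dvd_sum dvd_smult) auto
  qed
  have "(\<Prod>a\<in>insert 0 A. [:-a, 1:]) ^ \<mu> dvd f"
    using A' dvd_A dvd_0 by (intro prod_linear_power_dvd) auto
  moreover have "f \<noteq> 0"
  proof -
    \<comment> \<open>The lowest term of \<open>R a\<close> meets the constant term of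
      \<open>(x - a) ^ L\<close>, and the powers of \<open>a\<close> combine to
      \<open>K + 1 + L = s\<close>, the first moment that is nonzero again.
      \<open>L \<noteq> K + 1\<close> keeps the multiple of \<open>x ^ L\<close> away from this
      coefficient.\<close>
    have "coeff (R a * [:-a, 1:] ^ L) (K + 1) =
        of_nat ((N + K) choose (K + 1)) * l ^ (N - 1) * (-1) ^ L * a ^ s" for a
    proof -
      have "coeff (R a * [:-a, 1:] ^ L) (K + 1) = (\<Sum>k\<le>K + 1. coeff (R a) k * coeff ([:-a, 1:] ^ L) (K + 1 - k))"
        by (rule coeff_mult)
      also have "\<dots> = (\<Sum>k\<le>K + 1. if k = K + 1 then coeff (R a) (K + 1) * coeff ([:-a, 1:] ^ L) 0 else 0)"
        by (rule sum.cong) (use R_low in auto)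
      also have "\<dots> = coeff (R a) (K + 1) * (- a) ^ L"
        by (simp add: coeff_0_power)
      also have "(- a) ^ L = (-1) ^ L * a ^ L"
        by (rule power_minus)
      finally show ?thesis
        using R_low[of "K + 1" a] by (simp add: s power_add mult_ac)
    qed
    moreover have "coeff ([:0, 1::'a:] ^ L) (K + 1) = 0"
      using \<open>L \<noteq> K + 1\<close> by (metis coeff_monom monom_altdef smult_1_left)
    ultimately have "coeff f (K + 1) =
        of_nat ((N + K) choose (K + 1)) * l ^ (N - 1) * (-1) ^ L * (\<Sum>a\<in>A. c a * a ^ s)"
      unfolding f_eq sum_distrib_left by (auto simp: coeff_sum intro!: sum.cong)
    with cs bin \<open>l \<noteq> 0\<close> have "coeff f (K + 1) \<noteq> 0" by simp
    then show ?thesis by auto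
  qed
  ultimately have "degree ((\<Prod>a\<in>insert 0 A. [:-a, 1:]) ^ \<mu>) \<le> degree f"
    by (rule dvd_imp_degree_le)
  moreover have "degree f \<le> N + K + L"
  proof -
    have "degree ([:l, a:] ^ (N + K) * [:-a, 1:] ^ L) \<le> N + K + L" for a
    proof -
      have "degree ([:l, a:] ^ (N + K)) \<le> N + K"
        using degree_power_le[of "[:l, a:]" "N + K"] by (rule order.trans) auto
      then show ?thesis
        by (intro order.trans[OF degree_mult_le]) (simp add: degree_linear_power)
    qed
    then show ?thesis
      unfolding f_def
      by (intro degree_diff_le degree_sum_le A' order.trans[OF degree_smult_le]) (auto simp: degree_linear_power)
  qed
  ultimately show ?thesis
    using degree_prod_linear_insert_0[OF A'(1) A(2)] A(1) s by simp
qed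

section \<open>Choice of the exponents\<close>

text \<open>The hypothesis \<open>carry\<close> says that adding \<open>j\<close> to the digit of
  \<open>N\<close> at place \<open>P\<close> produces no carry, so Lucas reduces the binomial over
  \<open>P * j\<close> to \<open>u choose j\<close> with \<open>u < p\<close>. Absorption then
  passes to \<open>P * j + 1\<close> at the cost of the factor \<open>N\<close>.\<close>

lemma binomial_nonzero_of_digits:
  fixes p :: nat
  assumes p: "prime p" "CHAR('a::field) = p" and P: "P = p ^ m"
    and "\<not> p dvd N" and carry: "N mod (p * P) div P + j < p"
  shows "of_nat ((N + P * j) choose (P * j + 1)) \<noteq> (0::'a)"
proof -
  have prime: "prime CHAR('a)" using p by simp
  have "P > 0" "p > 0" using P p prime_gt_0_nat by auto
  have dvd_iff: "of_nat n = (0::'a) \<longleftrightarrow> p dvd n" for n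
    using of_nat_eq_0_iff_char_dvd[where ?'a = 'a] p by simp
  define u where "u = N mod (p * P) div P + j"
  have h: "N div P + j = p * (N div (p * P)) + u"
  proof -
    have "N mod (p * P) div P = (N div P) mod p"
      using mod_mult2_eq[of N P p] \<open>P > 0\<close> by (simp add: mult.commute)
    moreover have "N div (p * P) = N div P div p"
      by (simp add: div_mult2_eq mult.commute)
    ultimately show ?thesis
      by (simp add: u_def)
  qed
  have "N + P * j = P * (N div P + j) + N mod P"
    by (simp add: distrib_left)
  then have "of_nat ((N + P * j) choose (P * j)) = (of_nat ((N div P + j) choose j) :: 'a)"
    using lucas_prime_power[OF prime, of P m "N mod P" 0 "N div P + j" j] P p \<open>P > 0\<close> by simp
  also have "\<dots> = of_nat (u choose j)"
    using lucas_prime_power[OF prime, of p 1 u j "N div (p * P)" 0] p carry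
    unfolding h by (simp add: u_def)
  also have "\<dots> \<noteq> 0"
  proof
    assume "of_nat (u choose j) = (0::'a)"
    then have "p dvd (u choose j)" by (simp add: dvd_iff)
    moreover have "(u choose j) dvd fact u"
      using binomial_fact_lemma[of j u] by (metis dvd_triv_right le_add2 u_def)
    ultimately have "p \<le> u"
      using p(1) by (meson dvd_trans prime_dvd_fact_iff)
    with carry show False by (simp add: u_def)
  qed
  finally have "of_nat ((N + P * j) choose (P * j)) \<noteq> (0::'a)" .
  moreover have "(P * j + 1) * ((N + P * j) choose (P * j + 1)) = N * ((N + P * j) choose (P * j))"
    using binomial_absorption[of "P * j" "N + P * j"] binomial_absorb_comp[of "N + P * j" "P * j"] by simp
  then have "of_nat (P * j + 1) * of_nat ((N + P * j) choose (P * j + 1)) =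
      (of_nat N * of_nat ((N + P * j) choose (P * j)) :: 'a)"
    by (metis of_nat_mult)
  moreover have "of_nat N \<noteq> (0::'a)"
    using \<open>\<not> p dvd N\<close> by (simp add: dvd_iff)
  ultimately show ?thesis by auto
qed

text \<open>The left exponent equals \<open>N + (s - N mod s)\<close>; the second summand is
  positive, which covers \<open>z = 0\<close>.\<close>

lemma conjugate_of_residue:
  fixes z :: "'a::field"
  assumes "z = 0 \<or> z ^ N = 1" and "s > 0"
  shows "z ^ (s * (N div s + 1)) = z ^ (s - N mod s)"
proof -
  have "N mod s < s" using assms(2) by simp
  moreover have "s * (N div s + 1) = s * (N div s) + s" by simp
  ultimately have *: "s * (N div s + 1) = N + (s - N mod s)"
    using mult_div_mod_eq[of s N] by linarith
  show ?thesis
    unfolding * power_add using assms(1) \<open>N mod s < s\<close> by auto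
qed

text \<open>This contradicts the conclusion of \<open>stepanov_off_diagonal\<close>. Since
  \<open>N\<close> is below \<open>s * s / 3\<close>, it holds comfortably when \<open>\<mu>\<close>
  is near \<open>s / 2\<close>. For \<open>p = 3\<close>, where \<open>\<mu> = s / 3\<close>, the
  case \<open>d = 3\<close> is impossible because 3 does not divide
  \<open>s * s - 1\<close>.\<close>

lemma stepanov_exponent_bound:
  fixes p :: nat
  assumes "prime p" and s: "s = p * P" "P = p ^ n" "s \<ge> 5" and d: "d \<ge> 3" "d * N = s\<^sup>2 - 1"
    and d5: "\<not> (s = 5 \<and> d = 3)" and d8: "\<not> (s = 8 \<and> d = 3)"
    and \<mu>: "\<mu> = (if p = 2 then P - 1 else (p div 2) * P)"
  shows "N + s \<le> (s + 1) * \<mu>"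
proof -
  have "s\<^sup>2 > 0" using s(3) by simp
  then have dN: "d * N + 1 = s * s" using d(2) by (simp add: power2_eq_square)
  have dN3: "3 * N + 1 \<le> s * s"
    using dN d(1) mult_le_mono1[of 3 d N] by linarith
  have dN4: "4 * N + 1 \<le> s * s" if "d \<noteq> 3"
    using dN d(1) that mult_le_mono1[of 4 d N] by linarith
  have "p \<ge> 2" using \<open>prime p\<close> by (rule prime_ge_2_nat)
  moreover have "p \<noteq> 4" using \<open>prime p\<close> by auto
  ultimately consider "p = 2" | "p = 3" | "p \<ge> 5" by linarith
  then show ?thesis
  proof cases
    case 1
    have "P \<noteq> 3"
    proof
      assume "P = 3"
      moreover from this s(2) 1 have "n > 0" by (cases n) auto
      ultimately show False using s(2) 1 by (metis dvd_power even_numeral odd_numeral)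
    qed
    moreover have "s = 2 * P" using s(1) 1 by simp
    ultimately have "P \<ge> 4" using s(3) by simp
    define Q where "Q = P - 1"
    have Q: "P = Q + 1" "Q \<ge> 3" using \<open>P \<ge> 4\<close> by (simp_all add: Q_def)
    show ?thesis
    proof (cases "Q = 3")
      case True
      with s 1 Q d8 have "d \<noteq> 3" by simp
      from dN4[OF this] True Q s 1 show ?thesis by (simp add: \<mu>)
    next
      case False
      then have "4 * Q \<le> Q * Q" using Q by simp
      moreover have "3 * N + 1 \<le> 4 * (Q * Q) + 8 * Q + 4"
        using dN3 unfolding s(1) 1 Q by (simp add: algebra_simps)
      ultimately have "N + 2 * Q + 2 \<le> 2 * (Q * Q) + 3 * Q"
        using False Q by linarith
      then show ?thesis
        unfolding \<mu> s(1) 1 Q by (simp add: algebra_simps)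
    qed
  next
    case 2
    have "d \<noteq> 3"
    proof
      assume "d = 3"
      with dN have "3 * N + 1 = 3 * (3 * (P * P))" by (simp add: s(1) 2)
      then show False by presburger
    qed
    from dN4[OF this] have N: "4 * N + 1 \<le> 9 * (P * P)" by (simp add: s(1) 2)
    have "s = 3 * P" using s(1) 2 by simp
    with s(3) have "P = 2 \<or> P \<ge> 3" by linarith
    then have "N + 3 * P \<le> 3 * (P * P) + P"
    proof
      assume "P \<ge> 3"
      then have "3 * P \<le> P * P" by simp
      with N show ?thesis by linarith
    qed (use N in simp)
    then show ?thesis
      unfolding \<mu> s(1) 2 by (simp add: algebra_simps)
  next
    case 3
    define j where "j = p div 2"
    have p: "p = 2 * j + 1"
      using prime_odd_nat[OF \<open>prime p\<close>] 3 by (simp add: j_def)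
    have \<mu>': "\<mu> = j * P" using \<mu> 3 by (simp add: j_def)
    have s\<mu>: "s = 2 * \<mu> + P" by (simp add: s(1) p \<mu>' algebra_simps)
    have "j \<ge> 2" using 3 p by simp
    then have "2 * P \<le> \<mu>" by (simp add: \<mu>')
    with s\<mu> have "2 * s \<le> 5 * \<mu>" by linarith
    then have *: "2 * (s * s) \<le> 5 * (s * \<mu>)"
      using mult_le_mono2[of "2 * s" "5 * \<mu>" s] by (simp add: algebra_simps)
    have "N + s \<le> s * \<mu> + \<mu>"
    proof (cases "s \<ge> 9")
      case True
      then have "9 * s \<le> s * s" by simp
      with * \<open>2 * s \<le> 5 * \<mu>\<close> dN3 show ?thesis by linarith
    next
      case False
      have "P = 1"
      proof (rule ccontr)
        assume "P \<noteq> 1"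
        moreover have "P \<noteq> 0"
        proof
          assume "P = 0"
          with s(1,3) show False by simp
        qed
        ultimately have "P \<ge> 2" by linarith
        then have "5 * 2 \<le> p * P" using 3 by (intro mult_le_mono) auto
        with False s(1) show False by simp
      qed
      then have "j = 2 \<or> j = 3" using False s(1) p \<open>j \<ge> 2\<close> by auto
      then show ?thesis
      proof
        assume "j = 2"
        with \<open>P = 1\<close> s(1) p have "s = 5" "\<mu> = 2" by (simp_all add: \<mu>')
        with d5 dN4 show ?thesis by simp
      next
        assume "j = 3"
        with \<open>P = 1\<close> s(1) p have "s = 7" "\<mu> = 3" by (simp_all add: \<mu>')
        with dN3 show ?thesis by simp
      qed
    qed
    then show ?thesis by simp
  qed
qed

text \<open>\<open>d * N\<close> is -1 modulo \<open>p\<close>, so \<open>p\<close> does not divide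
  \<open>N\<close>. If \<open>p\<close> divided \<open>N div s + 1\<close>, the digit of
  \<open>N\<close> at place \<open>s\<close> would be \<open>p - 1\<close>, and the positive
  \<open>N mod s\<close> would push the remainder above \<open>(p - 1) * s\<close>.\<close>

lemma residue_exponent_digits:
  fixes p :: nat
  assumes p: "prime p" and s: "s = p ^ m" "s \<ge> 2" and dN: "d * N = s\<^sup>2 - 1"
    and r: "N mod (p * s) \<le> (p - 1) * s"
  shows "\<not> p dvd N" and "N mod s > 0" and "\<not> p dvd N div s + 1"
proof -
  have "m > 0" using s by (cases m) auto
  have nd: "\<not> p dvd s\<^sup>2 - 1"
  proof
    assume "p dvd s\<^sup>2 - 1"
    moreover have "p dvd s\<^sup>2" using \<open>m > 0\<close> by (simp add: s(1) power_mult[symmetric] dvd_power)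
    moreover have "s\<^sup>2 \<ge> 1" using s by simp
    ultimately have "p dvd 1" by (metis dvd_diffD1)
    with p show False by simp
  qed
  then show pN: "\<not> p dvd N" by (metis dN dvd_mult)
  have "p dvd s" using \<open>m > 0\<close> by (simp add: s(1) dvd_power)
  then show pos: "N mod s > 0"
    using pN by (metis dvd_trans mod_0_imp_dvd not_gr_zero)
  show "\<not> p dvd N div s + 1"
  proof
    assume "p dvd N div s + 1"
    then have "N div s mod p = p - 1"
      by (metis Suc_eq_plus1 mod_Suc dvd_imp_mod_0 diff_Suc_1 nat.distinct(1))
    then have "N mod (p * s) = s * (p - 1) + N mod s"
      using mod_mult2_eq[of N s p] by (simp add: mult.commute)
    with r pos show False by (simp add: mult.commute)
  qed
qed

section \<open>Excluding sets with exactly \<open>s\<close> elements\<close>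

lemma prop_D_card_neq:
  fixes l :: "'a::{field,finite}" and p :: nat
  assumes p: "prime p" and s: "s = p ^ m" "CARD('a) = s\<^sup>2" "s \<ge> 5"
    and d: "d \<ge> 3" "d dvd s\<^sup>2 - 1" and r: "((s\<^sup>2 - 1) div d) mod (p * s) \<le> (p - 1) * s"
    and "l \<noteq> 0" and A: "prop_D d l A"
  shows "card A \<noteq> s"
proof
  assume card: "card A = s"
  define N where "N = (s\<^sup>2 - 1) div d"
  have dN: "d * N = s\<^sup>2 - 1" using d by (simp add: N_def)
  have char: "CHAR('a) = p"
    using finite_field_CHAR_eq[of p "2 * m"] p s by (simp add: power_mult mult.commute)
  have prime: "prime CHAR('a)" "s = CHAR('a) ^ m" using char p s by simp_all
  have "m > 0" using s by (cases m) auto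
  define P where "P = p ^ (m - 1)"
  have sP: "s = p * P" using \<open>m > 0\<close> by (simp add: s(1) P_def power_eq_if)
  have "0 \<notin> A" using A by (auto simp: prop_D_def)
  have res: "a * b + l = 0 \<or> (a * b + l) ^ N = 1" if "a \<in> A" "b \<in> A" "a \<noteq> b" for a b
    using power_residues_Un_0_cases[of "a * b + l" d] A that d s by (auto simp: prop_D_def N_def)
  have "s > 0" using s(3) by linarith
  have conj: "(a * b + l) ^ (s * (N div s + 1)) = (a * b + l) ^ (s - N mod s)"
    if "a \<in> A" "b \<in> A" "a \<noteq> b" for a b
    using conjugate_of_residue[OF res[OF that] \<open>s > 0\<close>] .
  have "s \<ge> 2" using s by simp
  note digits = residue_exponent_digits[OF p s(1) this dN r[folded N_def]]
  have e: "of_nat (N div s + 1) \<noteq> (0::'a)"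
    using digits(3) char of_nat_eq_0_iff_char_dvd[where ?'a = 'a] by metis
  have "N mod s < s" using \<open>s > 0\<close> by simp
  then have "s = (s - N mod s) + (N mod s - 1) + 1"
    using digits(2) by simp
  then have bound: "N mod s \<le> N div s + 2"
    using set_conjugate_bound[OF prime card \<open>0 \<notin> A\<close> \<open>l \<noteq> 0\<close> conj _ e] by fastforce
  \<comment> \<open>Here \<open>N = 21\<close> has quotient 2 and remainder 5 modulo 8, which
    violates \<open>bound\<close>.\<close>
  have not8: "\<not> (s = 8 \<and> d = 3)"
  proof
    assume "s = 8 \<and> d = 3"
    with dN have "N = 21" by simp
    with bound \<open>s = 8 \<and> d = 3\<close> show False by simp
  qed
  \<comment> \<open>Here \<open>N = 8\<close> has quotient 1 and remainder 3 modulo 5, so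
    \<open>bound\<close> is attained and the separate argument is needed.\<close>
  have not5: "\<not> (s = 5 \<and> d = 3)"
  proof
    assume *: "s = 5 \<and> d = 3"
    with dN have "N = 8" by simp
    have "p = 5"
    proof -
      have "p dvd 5" using * sP by (metis dvd_triv_left)
      moreover have "prime (5::nat)" by simp
      ultimately show ?thesis using p primes_dvd_imp_eq by blast
    qed
    then show False
      using card_5_not_conjugate_squares[of A l] char card * \<open>0 \<notin> A\<close> \<open>l \<noteq> 0\<close> conj \<open>N = 8\<close> by simp
  qed
  define \<mu> where "\<mu> = (if p = 2 then P - 1 else (p div 2) * P)"
  have large: "N + s \<le> (s + 1) * \<mu>"
    using stepanov_exponent_bound[OF p sP P_def s(3) d(1) dN not5 not8 \<mu>_def] .
  show False
  \<comment> \<open>If \<open>N mod s\<close> exceeds \<open>\<mu>\<close>, then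
    \<open>large\<close> forces \<open>N div s + 2 \<le> \<mu>\<close>, against
    \<open>bound\<close>. Otherwise the digit of \<open>N\<close> at place \<open>P\<close> is small
    enough to add \<open>j\<close> without a carry.\<close>
  proof (cases "N mod s \<le> \<mu>")
    case False
    have "N = s * (N div s) + N mod s" "(s + 1) * \<mu> = s * \<mu> + \<mu>" by simp_all
    with False large have "s * (N div s) + s < s * \<mu>" by linarith
    then have "s * (N div s + 1) < s * \<mu>" by simp
    then have "N div s + 1 < \<mu>" using mult_less_cancel1 by blast
    with False bound show False by simp
  next
    case True
    define j where "j = p div 2"
    have "P > 0" using p prime_gt_0_nat by (simp add: P_def)
    have "N > 0" using digits(1) by (cases "N = 0") auto
    \<comment> \<open>The exponents are \<open>K = P * j\<close> and \<open>L = s - 1 - K\<close>.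
      For odd \<open>p\<close>, \<open>L = K + 1\<close> would mean \<open>P = 2\<close>, but
      \<open>P\<close> is odd.\<close>
    have j: "N mod s div P + j < p \<and> \<mu> \<le> P * j \<and> (\<exists>L. s = P * j + L + 1 \<and> \<mu> \<le> L \<and> L \<noteq> P * j + 1)"
    proof (cases "p = 2")
      case p2: True
      then have "N mod s < P" using True \<open>P > 0\<close> by (simp add: \<mu>_def)
      moreover have "s = P * j + (P - 1) + 1" using sP p2 \<open>P > 0\<close> by (simp add: j_def)
      ultimately show ?thesis
        using p2 \<open>P > 0\<close> by (auto simp: j_def \<mu>_def intro!: exI[of _ "P - 1"])
    next
      case p2: False
      then have "odd p" using p prime_odd_nat prime_ge_2_nat by (metis le_neq_implies_less)
      then have pj: "p = 2 * j + 1" by (simp add: j_def)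
      have \<mu>j: "\<mu> = P * j" using p2 by (simp add: \<mu>_def j_def)
      have "N mod s div P \<le> P * j div P" using True unfolding \<mu>j by (rule div_le_mono)
      with \<open>P > 0\<close> have "N mod s div P + j < p" by (simp add: pj)
      moreover have "odd P" using \<open>odd p\<close> by (simp add: P_def)
      then have "P \<noteq> 2" by auto
      moreover have "s = P * j + (P * j + P - 1) + 1" using sP \<open>P > 0\<close> by (simp add: pj algebra_simps)
      ultimately show ?thesis
        using \<open>P > 0\<close> by (auto simp: \<mu>j intro!: exI[of _ "P * j + P - 1"])
    qed
    then obtain L where L: "s = P * j + L + 1" "\<mu> \<le> L" "L \<noteq> P * j + 1" by blast
    have "of_nat ((N + P * j) choose (P * j + 1)) \<noteq> (0::'a)"
      using binomial_nonzero_of_digits[OF p char P_def digits(1)] j sP by simp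
    from stepanov_off_diagonal[OF card \<open>0 \<notin> A\<close> \<open>l \<noteq> 0\<close> \<open>N > 0\<close> res L(1) _ L(2,3) this] j
    have "(s + 1) * \<mu> < N + s" by blast
    with large show False by simp
  qed
qed

lemma prop_SD_card_neq:
  fixes l :: "'a::{field,finite}" and p :: nat
  assumes p: "prime p" and s: "s = p ^ m" "CARD('a) = s\<^sup>2" "s \<ge> 2"
    and d: "d \<ge> 2" "d dvd s\<^sup>2 - 1" and r: "((s\<^sup>2 - 1) div d) mod (p * s) \<le> (p - 1) * s"
    and "l \<noteq> 0" and A: "prop_SD d l A"
  shows "card A \<noteq> s"
proof
  assume card: "card A = s"
  define N where "N = (s\<^sup>2 - 1) div d"
  have dN: "d * N = s\<^sup>2 - 1" using d by (simp add: N_def)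
  have char: "CHAR('a) = p"
    using finite_field_CHAR_eq[of p "2 * m"] p s by (simp add: power_mult mult.commute)
  have prime: "prime CHAR('a)" "s = CHAR('a) ^ m" using char p s by simp_all
  have "0 \<notin> A" using A by (auto simp: prop_SD_def)
  have res: "a * b + l = 0 \<or> (a * b + l) ^ N = 1" if "a \<in> A" "b \<in> A" for a b
    using power_residues_Un_0_cases[of "a * b + l" d] A that d s by (auto simp: prop_SD_def N_def)
  have "s > 0" using s(3) by linarith
  have conj: "(a * b + l) ^ (s * (N div s + 1)) = (a * b + l) ^ (s - N mod s)"
    if "a \<in> A" "b \<in> A" for a b
    using conjugate_of_residue[OF res[OF that] \<open>s > 0\<close>] .
  note digits = residue_exponent_digits[OF p s(1) s(3) dN r[folded N_def]]
  have e: "of_nat (N div s + 1) \<noteq> (0::'a)"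
    using digits(3) char of_nat_eq_0_iff_char_dvd[where ?'a = 'a] by metis
  have "s - N mod s < s" using digits(2) \<open>s > 0\<close> by simp
  then have "s \<le> N div s + 1"
    using strong_set_conjugate_bound[OF prime card \<open>0 \<notin> A\<close> \<open>l \<noteq> 0\<close> conj _ e] by blast
  then have "s * s \<le> s * (N div s) + s"
    using mult_le_mono2[of s "N div s + 1" s] by simp
  \<comment> \<open>The bound \<open>s \<le> e\<close> makes \<open>N\<close> exceed
    \<open>s * s - s\<close>, whereas \<open>d \<ge> 2\<close> keeps it below half of
    \<open>s * s\<close>.\<close>
  then have "s * s < N + s"
    using mult_div_mod_eq[of s N] digits(2) by linarith
  moreover have "2 * N + 1 \<le> s * s"
  proof -
    have "s\<^sup>2 > 0" using \<open>s > 0\<close> by simp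
    then have "d * N + 1 = s * s" using dN by (simp add: power2_eq_square)
    then show ?thesis using d(1) mult_le_mono1[of 2 d N] by linarith
  qed
  moreover have "2 * s \<le> s * s" using s(3) by simp
  ultimately show False by linarith
qed

text \<open>Any larger set would contain a subset of exactly \<open>s\<close> elements with the same
  property.\<close>

lemma Max_card_le_of_hereditary:
  fixes Q :: "'a::finite set \<Rightarrow> bool"
  assumes "Q {}" and "\<And>A B. Q A \<Longrightarrow> B \<subseteq> A \<Longrightarrow> Q B" and "\<And>A. Q A \<Longrightarrow> card A \<noteq> s" and "s > 0"
  shows "int (Max {card A | A. Q A}) \<le> int s - 1"
proof -
  have "card A < s" if "Q A" for A
  proof (rule ccontr)
    assume "\<not> card A < s"
    then obtain B where "B \<subseteq> A" "card B = s"
      by (meson not_less obtain_subset_with_card_n)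
    with assms that show False by blast
  qed
  moreover have "finite {card A | A. Q A}" by simp
  moreover have "{card A | A. Q A} \<noteq> {}" using assms(1) by blast
  ultimately have "Max {card A | A. Q A} < s"
    by (subst Max_less_iff) auto
  then show ?thesis by simp
qed

theorem theorem4p5:
  fixes l :: "'a::{field,finite}" and p k q s :: nat
  assumes "prime p"
    and "q = p ^ k"
    and "q = s ^ 2"
    and "CARD('a) = q"
    and "l \<noteq> 0"
  shows "(\<forall>d r. d \<ge> 2 \<and> d dvd (q - 1) \<and> r = ((q - 1) div d) mod (p * s) \<and> r \<le> (p - 1) * s
            \<longrightarrow> int (MSD d l) \<le> int s - 1)
       \<and> (\<forall>d r. q \<ge> 25 \<and> d \<ge> 3 \<and> d dvd (q - 1) \<and> r = ((q - 1) div d) mod (p * s) \<and> r \<le> (p - 1) * s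
            \<longrightarrow> int (MD d l) \<le> int s - 1)"
proof -
  have "s dvd p ^ k" using assms(2,3) by (metis dvd_triv_left power2_eq_square)
  then obtain m where m: "s = p ^ m"
    using divides_primepow_nat[OF assms(1)] by blast
  have card: "CARD('a) = s\<^sup>2" using assms by simp
  have "s \<ge> 2"
  proof -
    have "card {0, 1::'a} \<le> CARD('a)" by (rule card_mono) auto
    then have "s\<^sup>2 > 1" by (simp add: card)
    then show ?thesis
      using power_le_one[of s 2] by (cases "s \<le> 1") auto
  qed
  have "int (MSD d l) \<le> int s - 1"
    if "d \<ge> 2" "d dvd (q - 1)" "((q - 1) div d) mod (p * s) \<le> (p - 1) * s" for d
    unfolding MSD_def
  proof (rule Max_card_le_of_hereditary)
    show "card A \<noteq> s" if "prop_SD d l A" for A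
      using prop_SD_card_neq[OF assms(1) m card \<open>s \<ge> 2\<close> _ _ _ assms(5) that] \<open>d \<ge> 2\<close>
        \<open>d dvd (q - 1)\<close> \<open>((q - 1) div d) mod (p * s) \<le> (p - 1) * s\<close> assms(3) by simp
  qed (use \<open>s \<ge> 2\<close> in \<open>auto simp: prop_SD_def\<close>)
  moreover have "int (MD d l) \<le> int s - 1"
    if "q \<ge> 25" "d \<ge> 3" "d dvd (q - 1)" "((q - 1) div d) mod (p * s) \<le> (p - 1) * s" for d
    unfolding MD_def
  proof (rule Max_card_le_of_hereditary)
    have "5\<^sup>2 \<le> s\<^sup>2" using \<open>q \<ge> 25\<close> assms(3) by simp
    then have "s \<ge> 5" by (rule power2_le_imp_le) simp
    show "card A \<noteq> s" if "prop_D d l A" for A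
      using prop_D_card_neq[OF assms(1) m card \<open>s \<ge> 5\<close> _ _ _ assms(5) that] \<open>d \<ge> 3\<close>
        \<open>d dvd (q - 1)\<close> \<open>((q - 1) div d) mod (p * s) \<le> (p - 1) * s\<close> assms(3) by simp
  qed (use \<open>s \<ge> 2\<close> in \<open>auto simp: prop_D_def\<close>)
  ultimately show ?thesis by blast
qed

end
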